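(* Suppose $\{G_i\}$ is a graph sequence with all vertices of degree at least three. If $\operatorname{girth}(G_n)\to\infty$, then $\{G_i\}$ is an expander light sequence.
   Context: A graph sequence is a sequence of finite connected undirected graphs $\{G_i\}$ with the number of vertices $|G_i|\to\infty$. The girth of a graph is the minimum number of edges of a non-trivial loop (cycle) in it. Subsets of $G$ mean subsets of its vertex set, which carries the graph metric. For a subset $A$ of a finite graph $G$, $\operatorname{halo}(A)$ is the set of vertices not in $A$ whose (open) $2$-ball in the graph metric intersects $A$, i.e. vertices outside $A$ adjacent to a vertex of $A$. A graph sequence $\{G_i\}$ is an expander light sequence if there is $c>0$ such that for any uniformly bounded sequence of subsets $A_n\subset G_n$ (i.e. the diameters of the $A_n$ in the graph metrics of the $G_n$ are bounded by a common finite constant) one has $|\operatorname{halo}(A_n)|\ge c\cdot|A_n|$ for infinitely many $n$. *)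

theory Defs
  imports "Graph_Theory.Graph_Theory"
begin

text \<open>
  An undirected graph is the locale predicate \<open>graph\<close>: a finite symmetric digraph without loops
  and parallel arcs, so that each undirected edge is a pair of opposite arcs. The degree of a
  vertex is therefore its \<open>out_degree\<close>.
\<close>

text \<open>A cycle of a symmetric digraph may run through one edge back and forth, so the trivial
  loops have to be excluded by requiring length at least three. The girth of a forest is \<open>\<infinity>\<close>.\<close>

definition girth :: "('a, 'b) pre_digraph \<Rightarrow> enat" where
  "girth G = (INF p\<in>{p. pre_digraph.cycle G p \<and> 3 \<le> length p}. enat (length p))"

definition graph_dist :: "('a, 'b) pre_digraph \<Rightarrow> 'a \<Rightarrow> 'a \<Rightarrow> ereal" where
  "graph_dist G = wf_digraph.\<mu> G (\<lambda>_. 1)"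

text \<open>The diameter of the empty set is \<open>-\<infinity>\<close>, so the empty set counts as bounded.\<close>

definition graph_diameter :: "('a, 'b) pre_digraph \<Rightarrow> 'a set \<Rightarrow> ereal" where
  "graph_diameter G A = (SUP x\<in>A. SUP y\<in>A. graph_dist G x y)"

definition halo :: "('a, 'b) pre_digraph \<Rightarrow> 'a set \<Rightarrow> 'a set" where
  "halo G A = {v \<in> verts G - A. {u \<in> verts G. graph_dist G v u < 2} \<inter> A \<noteq> {}}"

definition graph_sequence :: "(nat \<Rightarrow> ('a, 'b) pre_digraph) \<Rightarrow> bool" where
  "graph_sequence G \<longleftrightarrow>
     (\<forall>n. graph (G n) \<and> Digraph_Component.connected (G n)) \<and>
     filterlim (\<lambda>n. card (verts (G n))) at_top sequentially"

definition uniformly_bounded :: "(nat \<Rightarrow> ('a, 'b) pre_digraph) \<Rightarrow> (nat \<Rightarrow> 'a set) \<Rightarrow> bool" where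
  "uniformly_bounded G A \<longleftrightarrow> (\<exists>D::real. \<forall>n. graph_diameter (G n) (A n) \<le> ereal D)"

definition expander_light_sequence :: "(nat \<Rightarrow> ('a, 'b) pre_digraph) \<Rightarrow> bool" where
  "expander_light_sequence G \<longleftrightarrow>
     graph_sequence G \<and>
     (\<exists>c::real. c > 0 \<and>
       (\<forall>A. (\<forall>n. A n \<subseteq> verts (G n)) \<and> uniformly_bounded G A \<longrightarrow>
          (\<exists>\<^sub>\<infinity>n. real (card (halo (G n) (A n))) \<ge> c * real (card (A n)))))"

end

(*
  The constant is c = 1. A set A of diameter at most k lies in the ball of radius k around any
  vertex a of A. If the girth exceeds 2k + 4, then every vertex of the ball of radius k + 1 around a
  has at most one neighbour that is not farther from a: two such neighbours would be joined through
  a by a short walk that avoids the vertex, which closes up to a short cycle. Hence every v in A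
  has at least two neighbours farther from a, and no vertex is obtained in this way from two
  different v. This gives at least 2 |A| vertices in A Un halo A.
*)

theory Submission
  imports Defs
begin

unbundle no funcset_syntax

text \<open>Each arc is replaced by an opposite one. The vertex set is recorded so that a vertex
  avoided by the walk stays avoided after reversal.\<close>

lemma (in sym_digraph) awalk_reverse:
  assumes "awalk u p v"
  shows "\<exists>q. awalk v q u \<and> length q = length p \<and> set (awalk_verts v q) = set (awalk_verts u p)"
  using assms
proof (induction p arbitrary: u)
  case Nil
  then show ?case by (intro exI[of _ "[]"]) (auto simp: awalk_Nil_iff)
next
  case (Cons e p)
  then have e: "e \<in> arcs G" "tail G e = u" and p: "awalk (head G e) p v"
    by (auto simp: awalk_Cons_iff)
  from Cons.IH[OF p] obtain q where q: "awalk v q (head G e)" "length q = length p"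
    "set (awalk_verts v q) = set (awalk_verts (head G e) p)"
    by blast
  obtain e' where e': "e' \<in> arcs G" "tail G e' = head G e" "head G e' = u"
    using sym_arcs e unfolding symmetric_conv by metis
  have "awalk (head G e) [e'] u"
    using e' arc_implies_awalk[of e'] by simp
  moreover have "head G e \<in> set (awalk_verts (head G e) p)"
    using p hd_in_awalk_verts by blast
  ultimately show ?case
    using q e e' by (intro exI[of _ "q @ [e']"]) (auto simp: awalk_appendI set_awalk_verts_append)
qed

context wf_digraph begin

lemma awalk_cost_one: "awalk_cost (\<lambda>_. 1) p = real (length p)"
  by (induction p) auto

lemma graph_dist_le_length:
  assumes "awalk u p v"
  shows "graph_dist G u v \<le> ereal (real (length p))"
  using min_cost_le_walk_cost[OF assms, of "\<lambda>_. 1"] by (simp add: graph_dist_def awalk_cost_one)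

lemma graph_dist_arc:
  assumes "u \<rightarrow> v"
  shows "graph_dist G u v \<le> 1"
proof -
  obtain e where "e \<in> arcs G" "tail G e = u" "head G e = v"
    using assms by (rule reachableE)
  then have "awalk u [e] v"
    using arc_implies_awalk[of e] by simp
  from graph_dist_le_length[OF this] show ?thesis
    by (simp add: one_ereal_def)
qed

text \<open>Passing to a path cuts out closed subwalks, and none of these has negative cost when
  every arc costs 1.\<close>

lemma length_awalk_to_apath:
  assumes "awalk u p v"
  shows "length (awalk_to_apath p) \<le> length p"
  using awalk_to_path_no_neg_cyc_cost[OF assms, of "\<lambda>_. 1"] by (simp add: awalk_cost_one not_less)

lemma awalk_verts_awalk_to_apath:
  assumes "awalk u p v"
  shows "set (awalk_verts u (awalk_to_apath p)) \<subseteq> set (awalk_verts u p)"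
  using awalk_to_apath_subset[OF assms] set_awalk_verts[OF assms]
    set_awalk_verts[OF awalkI_apath[OF apath_awalk_to_apath[OF assms]]]
  by auto

text \<open>Cutting the closed subwalks out of \<open>p\<close> leaves a path that still avoids
  \<open>v\<close>; the arcs from \<open>v\<close> to \<open>u\<close> and from \<open>w\<close> to
  \<open>v\<close> close it to a cycle.\<close>

lemma girth_le_of_detour:
  assumes arcs: "v \<rightarrow> u" "w \<rightarrow> v" and "u \<noteq> w"
    and p: "awalk u p w" "v \<notin> set (awalk_verts u p)"
  shows "girth G \<le> enat (length p + 2)"
proof -
  define q where "q = awalk_to_apath p"
  have q: "apath u q w" "length q \<le> length p" "v \<notin> set (awalk_verts u q)"
    using p apath_awalk_to_apath length_awalk_to_apath awalk_verts_awalk_to_apath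
    unfolding q_def by blast+
  obtain e f where e: "e \<in> arcs G" "tail G e = v" "head G e = u"
    and f: "f \<in> arcs G" "tail G f = w" "head G f = v"
    using arcs by blast
  \<comment> \<open>Distinct ends force an arc in \<open>q\<close>, so the cycle has length at least
    three and is not one edge run back and forth.\<close>
  have "q \<noteq> []"
    using q(1) \<open>u \<noteq> w\<close> by (auto simp: apath_Nil_iff)
  have qf: "awalk u (q @ [f]) v"
    using q(1) f arc_implies_awalk[of f] by (intro awalk_appendI[of _ _ w]) (auto simp: apath_def)
  have "awlast u q = w"
    using q(1) by (auto simp: apath_def)
  \<comment> \<open>The cycle is based at \<open>v\<close>, and this is the tail of its vertex list;
    it is distinct because \<open>q\<close> is a path avoiding \<open>v\<close>.\<close>
  then have "awalk_verts u (q @ [f]) = awalk_verts u q @ [v]"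
    using awalk_verts_append[OF qf] f by simp
  then have "cycle (e # q @ [f])"
    using e qf q unfolding cycle_def by (intro exI[of _ v]) (auto simp: awalk_Cons_iff apath_def)
  moreover have "3 \<le> length (e # q @ [f])"
    using \<open>q \<noteq> []\<close> by (cases q) auto
  ultimately have "girth G \<le> enat (length (e # q @ [f]))"
    unfolding girth_def by (intro INF_lower) auto
  also have "\<dots> \<le> enat (length p + 2)"
    using q(2) by simp
  finally show ?thesis .
qed

end

lemma (in fin_digraph) graph_dist_awalk:
  assumes "u \<rightarrow>\<^sup>* v"
  obtains p where "awalk u p v" "graph_dist G u v = ereal (real (length p))"
  using min_cost_awalk[OF assms, of "\<lambda>_. 1"]
  by (auto simp: graph_dist_def awalk_cost_one apath_def)

text \<open>A visit to \<open>v\<close> would split off a strictly shorter initial part ending at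
  \<open>v\<close>, making \<open>v\<close> closer to \<open>a\<close> than
  \<open>u\<close>.\<close>

lemma (in fin_digraph) shortest_awalk_avoids:
  assumes "awalk a p u" "graph_dist G a u = ereal (real (length p))"
    and "graph_dist G a u \<le> graph_dist G a v" "u \<noteq> v"
  shows "v \<notin> set (awalk_verts a p)"
proof
  assume "v \<in> set (awalk_verts a p)"
  then obtain q r where qr: "p = q @ r" "awalk a q v" "awalk v r u"
    using awalk_decomp assms(1) by blast
  have "r \<noteq> []"
    using qr(3) \<open>u \<noteq> v\<close> by (auto simp: awalk_Nil_iff)
  have "ereal (real (length p)) \<le> ereal (real (length q))"
    using assms(2,3) graph_dist_le_length[OF qr(2)] by (metis order_trans)
  with qr(1) \<open>r \<noteq> []\<close> show False by simp
qed

context graph begin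

text \<open>Shortest walks from \<open>a\<close> to two such neighbours avoid \<open>v\<close> and
  join up to a detour around it. Its at most \<open>2 * k\<close> arcs and the two arcs at
  \<open>v\<close> account for \<open>2 * k + 2\<close>. Neighbours at the same distance as
  \<open>v\<close> are covered too.\<close>

lemma unique_parent:
  assumes arcs: "u \<rightarrow> v" "w \<rightarrow> v"
    and reach: "a \<rightarrow>\<^sup>* v"
    and closer: "graph_dist G a u \<le> graph_dist G a v" "graph_dist G a w \<le> graph_dist G a v"
    and radius: "graph_dist G a v \<le> ereal (real k)"
    and girth: "enat (2 * k + 2) < girth G"
  shows "u = w"
proof (rule ccontr)
  assume "u \<noteq> w"
  have sym: "v \<rightarrow> u" "v \<rightarrow> w"
    using arcs arcs_ends_symmetric[OF sym_arcs] by auto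
  then have "a \<rightarrow>\<^sup>* u" "a \<rightarrow>\<^sup>* w"
    using reach reachable_adj_trans by blast+
  then obtain p q where p: "awalk a p u" "graph_dist G a u = ereal (real (length p))"
    and q: "awalk a q w" "graph_dist G a w = ereal (real (length q))"
    by (metis graph_dist_awalk)
  have "u \<noteq> v" "w \<noteq> v"
    using arcs adj_not_same by auto
  then have avoid: "v \<notin> set (awalk_verts a p)" "v \<notin> set (awalk_verts a q)"
    using shortest_awalk_avoids p q closer by blast+
  obtain p' where p': "awalk u p' a" "length p' = length p"
    "set (awalk_verts u p') = set (awalk_verts a p)"
    using awalk_reverse[OF p(1)] by blast
  have "v \<notin> set (awalk_verts u (p' @ q))"
    using avoid p' by (simp add: set_awalk_verts_append[OF p'(1) q(1)])
  then have "girth G \<le> enat (length (p' @ q) + 2)"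
    by (rule girth_le_of_detour[OF sym(1) arcs(2) \<open>u \<noteq> w\<close> awalk_appendI[OF p'(1) q(1)]])
  moreover have "ereal (real (length p)) \<le> ereal (real k)" "ereal (real (length q)) \<le> ereal (real k)"
    using p(2) q(2) closer radius by (metis order_trans)+
  then have "enat (length (p' @ q) + 2) \<le> enat (2 * k + 2)"
    using p'(2) by simp
  ultimately show False
    using girth by (metis not_le order_trans)
qed

lemma card_neighbours: "card {w. v \<rightarrow> w} = out_degree G v"
proof -
  have "inj_on (head G) (out_arcs G v)"
    by (auto intro!: inj_onI no_multi_arcs simp: arc_to_ends_def)
  moreover have "{w. v \<rightarrow> w} = head G ` out_arcs G v"
    by (auto simp: arcs_ends_conv)
  ultimately show ?thesis
    by (simp add: out_degree_def card_image)
qed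

lemma card_le_card_halo:
  assumes conn: "Digraph_Component.connected G"
    and deg: "\<And>v. v \<in> verts G \<Longrightarrow> 3 \<le> out_degree G v"
    and A: "A \<subseteq> verts G"
    and diam: "graph_diameter G A \<le> ereal (real k)"
    and girth: "enat (2 * k + 4) < girth G"
  shows "card A \<le> card (halo G A)"
proof (cases "A = {}")
  case False
  then obtain a where a: "a \<in> A" by blast
  have reach: "a \<rightarrow>\<^sup>* v" if "v \<in> verts G" for v
    using symmetric_connected_imp_strongly_connected[OF sym_arcs conn] that a A by blast
  have fin: "finite A" "finite (halo G A)"
    using A finite_subset[OF A] by (auto simp: halo_def)
  have dist_A: "graph_dist G a v \<le> ereal (real k)" if "v \<in> A" for v
  proof -
    have "graph_dist G a v \<le> graph_diameter G A"
      unfolding graph_diameter_def by (rule SUP_upper2[OF a SUP_upper[OF that]])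
    from this diam show ?thesis by (rule order_trans)
  qed
  \<comment> \<open>This is applied at vertices of \<open>A\<close> and also at their neighbours
    farther from \<open>a\<close>, which may have distance \<open>k + 1\<close>. Hence the radius
    \<open>Suc k\<close> and the girth bound \<open>2 * k + 4\<close>.\<close>
  have unique: "u = w" if "u \<rightarrow> v" "w \<rightarrow> v" "graph_dist G a u \<le> graph_dist G a v"
    "graph_dist G a w \<le> graph_dist G a v" "graph_dist G a v \<le> ereal (real (Suc k))" for u v w
  proof (rule unique_parent[OF that(1,2) _ that(3-5)])
    show "a \<rightarrow>\<^sup>* v"
      using reach adj_in_verts(2) \<open>u \<rightarrow> v\<close> by blast
    have "2 * Suc k + 2 = 2 * k + 4"
      by simp
    with girth show "enat (2 * Suc k + 2) < girth G"
      by metis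
  qed
  \<comment> \<open>The children of \<open>v\<close> when the ball around \<open>a\<close> is seen
    as a tree rooted at \<open>a\<close>.\<close>
  define C where "C v = {w. v \<rightarrow> w \<and> graph_dist G a v < graph_dist G a w}" for v
  have fin_N: "finite {w. v \<rightarrow> w}" for v
    by (rule finite_subset[of _ "verts G"]) (auto intro: adj_in_verts)
  have fin_C: "finite (C v)" for v
    by (rule finite_subset[OF _ fin_N[of v]]) (auto simp: C_def)
  have dist_C: "graph_dist G a w \<le> ereal (real (Suc k))" if "v \<in> A" "w \<in> C v" for v w
  proof -
    obtain e where e: "e \<in> arcs G" "arc_to_ends G e = (v, w)"
      using \<open>w \<in> C v\<close> by (auto simp: C_def arc_to_ends_def)
    have "graph_dist G a w \<le> graph_dist G a v + 1"
      using pos_cost_mu_triangle[OF _ e(2,1), of "\<lambda>_. 1" a]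
      by (simp add: graph_dist_def one_ereal_def)
    also have "\<dots> \<le> ereal (real k) + 1"
      using dist_A[OF \<open>v \<in> A\<close>] by (rule add_right_mono)
    finally show ?thesis by (simp add: one_ereal_def add.commute)
  qed
  have card_C: "2 \<le> card (C v)" if "v \<in> A" for v
  proof -
    have "graph_dist G a v \<le> ereal (real (Suc k))"
      using dist_A[OF that] by (rule order_trans) simp
    \<comment> \<open>Neighbours outside \<open>C v\<close> are not farther from \<open>a\<close>
      than \<open>v\<close>, so there is at most one; degree at least three leaves two in
      \<open>C v\<close>.\<close>
    then have "u = w" if "u \<in> {w. v \<rightarrow> w} - C v" "w \<in> {w. v \<rightarrow> w} - C v" for u w
      using that unique[of u v w] arcs_ends_symmetric[OF sym_arcs] by (auto simp: C_def not_less)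
    then have "card ({w. v \<rightarrow> w} - C v) \<le> 1"
      using fin_N[of v] by (auto simp: card_le_Suc0_iff_eq)
    moreover have "card ({w. v \<rightarrow> w} - C v) = card {w. v \<rightarrow> w} - card (C v)"
      using fin_C by (intro card_Diff_subset) (auto simp: C_def)
    ultimately show ?thesis
      using deg[of v] A that by (auto simp: card_neighbours)
  qed
  \<comment> \<open>Here \<open>unique\<close> is used at the common child \<open>w\<close>, which
    has both \<open>u\<close> and \<open>v\<close> as neighbours closer to \<open>a\<close>.\<close>
  have "u = v" if "u \<in> A" "v \<in> A" "w \<in> C u" "w \<in> C v" for u v w
    using unique[of u w v] that(3,4) dist_C[OF that(1,3)] by (simp add: C_def less_imp_le)
  then have disjoint: "\<forall>u\<in>A. \<forall>v\<in>A. u \<noteq> v \<longrightarrow> C u \<inter> C v = {}"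
    by blast
  have subset: "(\<Union>v\<in>A. C v) \<subseteq> A \<union> halo G A"
  proof safe
    fix v w assume "v \<in> A" "w \<in> C v" "w \<notin> halo G A"
    then have "w \<rightarrow> v" "w \<in> verts G"
      using arcs_ends_symmetric[OF sym_arcs] adj_in_verts by (auto simp: C_def)
    \<comment> \<open>\<open>halo\<close> measures the distance from the outer vertex, hence the
      reversed arc from \<open>w\<close> to \<open>v\<close>.\<close>
    moreover have "graph_dist G w v < 2"
      by (rule le_less_trans[OF graph_dist_arc[OF \<open>w \<rightarrow> v\<close>]]) simp
    ultimately show "w \<in> A"
      using \<open>v \<in> A\<close> \<open>w \<notin> halo G A\<close> A by (auto simp: halo_def)
  qed
  \<comment> \<open>Each vertex has two children and no child is shared. At most
    \<open>card A\<close> of them lie in \<open>A\<close>; the halo must hold the rest.\<close>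
  have "2 * card A = (\<Sum>v\<in>A. 2)"
    by simp
  also have "\<dots> \<le> (\<Sum>v\<in>A. card (C v))"
    by (rule sum_mono) (rule card_C)
  also have "\<dots> = card (\<Union>v\<in>A. C v)"
    using fin(1) fin_C disjoint by (intro card_UN_disjoint[symmetric]) blast+
  also have "\<dots> \<le> card (A \<union> halo G A)"
    using fin subset by (intro card_mono) auto
  also have "\<dots> \<le> card A + card (halo G A)"
    by (rule card_Un_le)
  finally show ?thesis by simp
qed simp

end

theorem proposition7p11:
  fixes G :: "nat \<Rightarrow> ('a, 'b) pre_digraph"
  assumes "graph_sequence G"
    and "\<And>n v. v \<in> verts (G n) \<Longrightarrow> out_degree (G n) v \<ge> 3"
    and "(\<lambda>n. girth (G n)) \<longlonglongrightarrow> \<infinity>"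
  shows "expander_light_sequence G"
proof -
  have "\<exists>\<^sub>\<infinity>n. real (card (halo (G n) (A n))) \<ge> 1 * real (card (A n))"
    if A: "\<And>n. A n \<subseteq> verts (G n)" and bounded: "uniformly_bounded G A" for A
  proof -
    obtain D where D: "\<And>n. graph_diameter (G n) (A n) \<le> ereal D"
      using bounded by (auto simp: uniformly_bounded_def)
    \<comment> \<open>Rounding the diameter bound up gives one radius, and so one girth threshold,
      for all \<open>n\<close>.\<close>
    obtain k :: nat where "D \<le> real k"
      using real_arch_simple by blast
    then have k: "graph_diameter (G n) (A n) \<le> ereal (real k)" for n
      using D[of n] by (meson ereal_less_eq(3) order_trans)
    have "\<forall>\<^sub>F n in sequentially. enat (2 * k + 4) < girth (G n)"
      by (rule order_tendstoD(1)[OF assms(3)]) simp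
    then have "\<forall>\<^sub>F n in sequentially. card (A n) \<le> card (halo (G n) (A n))"
    proof eventually_elim
      case (elim n)
      then show ?case
        using assms(1,2) A k by (intro graph.card_le_card_halo) (auto simp: graph_sequence_def)
    qed
    \<comment> \<open>The inequality holds from some \<open>n\<close> on, hence infinitely
      often.\<close>
    then show ?thesis
      by (auto simp: cofinite_eq_sequentially intro: eventually_frequently)
  qed
  then show ?thesis
    using assms(1) unfolding expander_light_sequence_def by (intro conjI exI[of _ "1::real"]) auto
qed

end
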